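(* Let $V$, $H$ be real Hilbert spaces, $A : V \to H$ a bounded injective linear operator with adjoint $A^* : H \to V$, and $P : H \to H$ a compact orthogonal projector with $\mathrm{Range}\, P \subset \overline{\mathrm{Range}\, A}$. Let $u \in V$ and $g \in H$ satisfy $Au = g$. Let $\delta_0>0$ and let $(g^\delta)_{0<\delta<\delta_0}$ be a family in $H$ such that, for every $\delta \in (0,\delta_0)$, $$\|g_\perp^\delta\|_H < \delta < \|g^\delta\|_H, \qquad \|g^\delta - g\|_H = \delta, \qquad P g^\delta = P g.$$ For each $\delta$, let $u^\delta = A^* p^\delta$, where $p^\delta \in H$ is a minimizer over $q \in H$ of $$G_P^\delta(q) = \frac{1}{2}\|A^* q\|_V^2 + \delta \|(I-P) q\|_H - (g^\delta, q)_H.$$ Then $$\lim_{\delta \to 0} u^\delta = u \quad \text{in } V.$$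
   Context: $g_\perp^\delta$ denotes the orthogonal projection of $g^\delta$ on $(\mathrm{Range}\, A)^\perp \subset H$. $I$ is the identity operator of $H$. $P$ is the orthogonal projector on a closed subspace of $H$ and does not depend on $\delta$. Here $g$ is the exact data, $u$ the exact solution, and $g^\delta$ noisy data with noise amplitude $\delta$. Under the condition $\|g_\perp^\delta\|_H<\delta$, minimizers $p^\delta$ of $G_P^\delta$ exist and $A^*p^\delta$ does not depend on the choice of the minimizer: $u^\delta$ is the unique element of minimal norm in $\{ v \in V : \|Av - g^\delta\|_H \le \delta,\ PAv = Pg^\delta \}$. *)

theory Defs
  imports "HOL-Analysis.Analysis"
begin

text \<open>Real Hilbert spaces are types of sort \<open>{real_inner, complete_space}\<close>. For a bounded linear
  operator between them the Hilbert space adjoint exists (Riesz) and is unique, so it is the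
  library's \<open>adjoint\<close>.\<close>

text \<open>For a closed subspace \<open>S\<close> of a Hilbert space the point described here exists and is unique;
  for other sets \<open>S\<close> the value is not meaningful.\<close>

definition orth_proj :: "'a::real_inner set \<Rightarrow> 'a \<Rightarrow> 'a" where
  "orth_proj S x = (THE y. y \<in> S \<and> x - y \<in> orthogonal_comp S)"

definition orthogonal_projector :: "('a::real_inner \<Rightarrow> 'a) \<Rightarrow> bool" where
  "orthogonal_projector P \<longleftrightarrow> (\<exists>S. subspace S \<and> closed S \<and> P = orth_proj S)"

definition compact_operator :: "('a::real_normed_vector \<Rightarrow> 'b::real_normed_vector) \<Rightarrow> bool" where
  "compact_operator f \<longleftrightarrow> bounded_linear f \<and> (\<forall>B. bounded B \<longrightarrow> compact (closure (f ` B)))"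

definition G_P ::
  "('v::real_inner \<Rightarrow> 'h::real_inner) \<Rightarrow> ('h \<Rightarrow> 'h) \<Rightarrow> real \<Rightarrow> 'h \<Rightarrow> 'h \<Rightarrow> real" where
  "G_P A P \<delta> g\<^sub>\<delta> q = 1/2 * (norm (adjoint A q))\<^sup>2 + \<delta> * norm (q - P q) - g\<^sub>\<delta> \<bullet> q"

end

theory Submission
  imports Defs
begin

text \<open>
  Write \<open>u\<^sub>\<delta> = A\<^sup>* p\<^sub>\<delta>\<close>. The functional is convex, so its minimality at \<open>p\<^sub>\<delta>\<close> gives a
  variational inequality, lemma \<open>G_P_variational_inequality\<close>, in which the quadratic part is replaced by
  its derivative. Two test points carry all the information that is needed.

  Moving from \<open>p\<^sub>\<delta>\<close> against the residual \<open>A u\<^sub>\<delta> - g\<^sup>\<delta>\<close> bounds this residual by \<open>\<delta>\<close>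
  (\<open>G_P_minimizer_residual\<close>), hence \<open>\<parallel>A u\<^sub>\<delta> - A u\<parallel> \<le> 2 \<delta>\<close> and \<open>A u\<^sub>\<delta> \<rightarrow> A u\<close>.
  Moving from \<open>p\<^sub>\<delta>\<close> to the origin gives
  \<open>\<parallel>u\<^sub>\<delta>\<parallel>\<^sup>2 + \<delta> \<parallel>(I - P) p\<^sub>\<delta>\<parallel> \<le> (g\<^sup>\<delta>, p\<^sub>\<delta>)\<close>. The noise \<open>g\<^sup>\<delta> - g\<close> has norm \<open>\<delta>\<close> and is
  orthogonal to the range of \<open>P\<close>, so it pairs with \<open>p\<^sub>\<delta>\<close> only through \<open>(I - P) p\<^sub>\<delta>\<close>; the penalty term
  absorbs this pairing exactly, and \<open>\<parallel>u\<^sub>\<delta>\<parallel>\<^sup>2 \<le> (A u, p\<^sub>\<delta>) = (u, u\<^sub>\<delta>)\<close>. Hence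
  \<open>\<parallel>u\<^sub>\<delta>\<parallel> \<le> \<parallel>u\<parallel>\<close> (\<open>G_P_minimizer_norm_le\<close>).

  Convergence of \<open>A u\<^sub>\<delta>\<close> alone does not control \<open>u\<^sub>\<delta>\<close>, since \<open>A\<close> need not have a bounded inverse. The
  norm bound supplies what is missing: as \<open>A\<close> is injective, the range of \<open>A\<^sup>*\<close> is dense, so
  \<open>u\<^sub>\<delta>\<close> converges to \<open>u\<close> weakly, and weak convergence without excess of norm is strong convergence
  (\<open>tendsto_of_image_tendsto_and_norm_le\<close>).

  The Hilbert space facts behind this (existence of orthogonal projections, of Riesz
  representatives and of adjoints) all come from \<open>projection_theorem\<close>.
\<close>

section \<open>Orthogonal projections and adjoints in Hilbert spaces\<close>

text \<open>The almost closest points of \<open>S\<close> to \<open>x\<close> form nested closed sets, whose diameters tend to zero by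
  the parallelogram identity. Their common point is a closest point, and perturbing it along \<open>S\<close>
  shows that its difference to \<open>x\<close> is orthogonal to \<open>S\<close>.\<close>

lemma projection_theorem:
  fixes S :: "'a::{real_inner, complete_space} set"
  assumes S: "subspace S" "closed S"
  shows "\<exists>y\<in>S. x - y \<in> orthogonal_comp S"
proof -
  define d where "d = (INF y\<in>S. (norm (x - y))\<^sup>2)"
  have ne: "S \<noteq> {}"
    using subspace_0[OF S(1)] by auto
  have bdd: "bdd_below ((\<lambda>y. (norm (x - y))\<^sup>2) ` S)"
    by (rule bdd_belowI2[where m = 0]) simp
  have d_le: "d \<le> (norm (x - y))\<^sup>2" if "y \<in> S" for y
    unfolding d_def using bdd that by (rule cINF_lower)
  define T where "T n = {y \<in> S. (norm (x - y))\<^sup>2 \<le> d + 1 / Suc n}" for n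
  have "\<exists>a. \<forall>n. a \<in> T n"
  proof (rule decreasing_closed_nest)
    show "closed (T n)" for n
      unfolding T_def Collect_conj_eq Collect_mem_eq
      by (intro closed_Int S closed_Collect_le continuous_intros)
    show "T n \<noteq> {}" for n
    proof -
      have "d < d + 1 / Suc n"
        by simp
      then obtain y where "y \<in> S" "(norm (x - y))\<^sup>2 < d + 1 / Suc n"
        unfolding d_def cINF_less_iff[OF ne bdd] by blast
      then show ?thesis
        by (auto simp: T_def)
    qed
    show "T n \<subseteq> T m" if "m \<le> n" for m n
    proof -
      have "1 / real (Suc n) \<le> 1 / real (Suc m)"
        using that by (simp add: frac_le)
      then show ?thesis
        by (auto simp: T_def)
    qed
    show "\<exists>n. \<forall>y\<in>T n. \<forall>z\<in>T n. dist y z < e" if e: "e > 0" for e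
    proof -
      obtain n where n: "1 / real (Suc n) < e\<^sup>2 / 4"
        using nat_approx_posE[of "e\<^sup>2 / 4"] e by auto
      have "dist y z < e" if "y \<in> T n" "z \<in> T n" for y z
      proof -
        have "(1/2) *\<^sub>R (y + z) \<in> S"
          using that S(1) by (auto simp: T_def intro!: subspace_scale subspace_add)
        then have "4 * d \<le> 4 * (norm (x - (1/2) *\<^sub>R (y + z)))\<^sup>2"
          using d_le by simp
        also have "\<dots> = 2 * (norm (x - y))\<^sup>2 + 2 * (norm (x - z))\<^sup>2 - (norm (y - z))\<^sup>2"
          by (simp add: power2_norm_eq_inner inner_diff inner_add inner_commute field_simps)
        finally have "(norm (y - z))\<^sup>2 < e\<^sup>2"
          using that n unfolding T_def by auto
        then show ?thesis
          using e by (simp add: dist_norm power_less_imp_less_base)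
      qed
      then show ?thesis by blast
    qed
  qed blast
  then obtain a where a: "\<And>n. a \<in> T n"
    by blast
  then have "a \<in> S"
    by (simp add: T_def)
  have "(norm (x - a))\<^sup>2 \<le> d"
  proof (rule field_le_epsilon)
    fix e :: real assume "e > 0"
    then obtain n where "1 / real (Suc n) < e"
      using nat_approx_posE by blast
    then show "(norm (x - a))\<^sup>2 \<le> d + e"
      using a[of n] by (auto simp: T_def)
  qed
  then have minimal: "(norm (x - a))\<^sup>2 \<le> (norm (x - y))\<^sup>2" if "y \<in> S" for y
    using d_le[OF that] by linarith
  have "(x - a) \<bullet> s = 0" if "s \<in> S" for s
  proof (cases "s = 0")
    case False
    \<comment> \<open>With this \<open>t\<close>, the point \<open>a + t s\<close> is the point closest to \<open>x\<close> on the line through \<open>a\<close> in direction \<open>s\<close>.\<close>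
    define t where "t = ((x - a) \<bullet> s) / (s \<bullet> s)"
    have "a + t *\<^sub>R s \<in> S"
      using \<open>a \<in> S\<close> that S(1) by (auto intro: subspace_scale subspace_add)
    then have "(norm (x - a))\<^sup>2 \<le> (norm ((x - a) - t *\<^sub>R s))\<^sup>2"
      using minimal by (simp add: diff_diff_eq)
    also have "\<dots> = (norm (x - a))\<^sup>2 - 2 * t * ((x - a) \<bullet> s) + t * t * (s \<bullet> s)"
      unfolding power2_norm_eq_inner by (simp add: inner_diff inner_commute algebra_simps)
    also have "\<dots> = (norm (x - a))\<^sup>2 - ((x - a) \<bullet> s)\<^sup>2 / (s \<bullet> s)"
      using False by (simp add: t_def field_simps power2_eq_square)
    finally have "((x - a) \<bullet> s)\<^sup>2 / (s \<bullet> s) \<le> 0"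
      by simp
    then show ?thesis
      using False by (auto simp: divide_le_0_iff not_le[symmetric] simp flip: power2_norm_eq_inner)
  qed simp
  then show ?thesis
    using \<open>a \<in> S\<close> by (auto simp: orthogonal_comp_def orthogonal_def inner_commute)
qed

lemma orth_proj_in_and_residual:
  fixes S :: "'a::{real_inner, complete_space} set"
  assumes S: "subspace S" "closed S"
  shows "orth_proj S x \<in> S" "x - orth_proj S x \<in> orthogonal_comp S"
proof -
  have "\<exists>!y. y \<in> S \<and> x - y \<in> orthogonal_comp S"
  proof (rule ex_ex1I)
    show "\<exists>y. y \<in> S \<and> x - y \<in> orthogonal_comp S"
      using projection_theorem[OF S] by blast
    fix y z assume y: "y \<in> S \<and> x - y \<in> orthogonal_comp S" and z: "z \<in> S \<and> x - z \<in> orthogonal_comp S"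
    then have "y - z \<in> S" "(x - z) - (x - y) \<in> orthogonal_comp S"
      using S(1) subspace_orthogonal_comp by (blast intro: subspace_diff)+
    then have "(y - z) \<bullet> (y - z) = 0"
      by (simp add: orthogonal_comp_def orthogonal_def)
    then show "y = z"
      by simp
  qed
  from theI'[OF this] show "orth_proj S x \<in> S" "x - orth_proj S x \<in> orthogonal_comp S"
    unfolding orth_proj_def by auto
qed

lemma orthogonal_projector_residual:
  fixes P :: "'a::{real_inner, complete_space} \<Rightarrow> 'a"
  assumes "orthogonal_projector P"
  shows "(x - P x) \<bullet> P y = 0"
proof -
  obtain S where S: "subspace S" "closed S" and P: "P = orth_proj S"
    using assms unfolding orthogonal_projector_def by blast
  show ?thesis
    using orth_proj_in_and_residual[OF S]
    by (simp add: P orthogonal_comp_def orthogonal_def inner_commute)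
qed

text \<open>Pythagoras for \<open>x = (x - P x) + P x\<close>.\<close>

lemma orthogonal_projector_residual_norm_le:
  fixes P :: "'a::{real_inner, complete_space} \<Rightarrow> 'a"
  assumes "orthogonal_projector P"
  shows "norm (x - P x) \<le> norm x"
proof -
  have "(norm (x - P x))\<^sup>2 + (norm (P x))\<^sup>2 = (norm ((x - P x) + P x))\<^sup>2"
    using orthogonal_projector_residual[OF assms, of x x] unfolding power2_norm_eq_inner
    by (simp only: inner_add_left inner_add_right inner_commute[of "P x" "x - P x"])
  then have "(norm (x - P x))\<^sup>2 \<le> (norm x)\<^sup>2"
    unfolding diff_add_cancel using zero_le_power2[of "norm (P x)"] by linarith
  then show ?thesis
    by simp
qed

text \<open>The kernel of a nonzero \<open>f\<close> is a closed hyperplane; the representative is a multiple of a normal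
  vector \<open>z\<close> to it, because \<open>x - (f x / f z) z\<close> always lies in the kernel.\<close>

lemma riesz_representation:
  fixes f :: "'a::{real_inner, complete_space} \<Rightarrow> real"
  assumes "bounded_linear f"
  shows "\<exists>w. \<forall>x. f x = x \<bullet> w"
proof (cases "\<forall>x. f x = 0")
  case True
  then show ?thesis
    by (intro exI[of _ 0]) simp
next
  case False
  then obtain x\<^sub>0 where x\<^sub>0: "f x\<^sub>0 \<noteq> 0"
    by blast
  interpret bounded_linear f by fact
  let ?K = "{x. f x = 0}"
  have "subspace ?K"
    by (simp add: subspace_def add scaleR zero)
  moreover have "closed ?K"
    by (intro closed_Collect_eq continuous_intros linear_continuous_on assms)
  ultimately obtain y where y: "f y = 0" "x\<^sub>0 - y \<in> orthogonal_comp ?K"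
    using projection_theorem by blast
  define z where "z = x\<^sub>0 - y"
  have fz: "f z \<noteq> 0"
    using x\<^sub>0 y by (simp add: z_def diff)
  then have "z \<noteq> 0"
    using zero by auto
  have "f x = x \<bullet> ((f z / (z \<bullet> z)) *\<^sub>R z)" for x
  proof -
    have "f (x - (f x / f z) *\<^sub>R z) = 0"
      using fz by (simp add: diff scaleR)
    then have "(x - (f x / f z) *\<^sub>R z) \<bullet> z = 0"
      using y(2) unfolding z_def[symmetric] by (simp add: orthogonal_comp_def orthogonal_def)
    then show ?thesis
      using fz \<open>z \<noteq> 0\<close> by (simp add: inner_diff field_simps)
  qed
  then show ?thesis
    by blast
qed

text \<open>The adjoint is a choice among all maps with this property, so the point is that one exists;
  Riesz representation of \<open>x \<mapsto> A x \<bullet> y\<close> provides it.\<close>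

lemma inner_adjoint:
  fixes A :: "'a::{real_inner, complete_space} \<Rightarrow> 'b::real_inner"
  assumes "bounded_linear A"
  shows "x \<bullet> adjoint A y = A x \<bullet> y"
proof -
  have "\<exists>w. \<forall>x. A x \<bullet> y = x \<bullet> w" for y
    using riesz_representation[OF bounded_linear_compose[OF bounded_linear_inner_left assms]] by blast
  then obtain B where B: "\<forall>x y. A x \<bullet> y = x \<bullet> B y"
    by metis
  then show ?thesis
    using adjoint_unique[OF B] by simp
qed

lemma linear_adjoint:
  fixes A :: "'a::{real_inner, complete_space} \<Rightarrow> 'b::real_inner"
  assumes "bounded_linear A"
  shows "linear (adjoint A)"
proof (rule linearI)
  show "adjoint A (y + z) = adjoint A y + adjoint A z" for y z
    by (rule vector_eq_ldot[THEN iffD1]) (simp add: inner_adjoint[OF assms] inner_add)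
  show "adjoint A (c *\<^sub>R y) = c *\<^sub>R adjoint A y" for c y
    by (rule vector_eq_ldot[THEN iffD1]) (simp add: inner_adjoint[OF assms])
qed

lemma subspace_closure:
  fixes S :: "'a::real_normed_vector set"
  assumes "subspace S"
  shows "subspace (closure S)"
proof (unfold subspace_def, intro conjI ballI allI)
  show "0 \<in> closure S"
    using subspace_0[OF assms] closure_subset by blast
  fix x assume "x \<in> closure S"
  then obtain X where X: "\<And>n. X n \<in> S" "X \<longlonglongrightarrow> x"
    unfolding closure_sequential by metis
  show "x + y \<in> closure S" if y: "y \<in> closure S" for y
  proof -
    obtain Y where Y: "\<And>n. Y n \<in> S" "Y \<longlonglongrightarrow> y"
      using y unfolding closure_sequential by auto
    show ?thesis
      unfolding closure_sequential using X Y subspace_add[OF assms]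
      by (intro exI[of _ "\<lambda>n. X n + Y n"]) (auto intro: tendsto_add)
  qed
  show "c *\<^sub>R x \<in> closure S" for c
    unfolding closure_sequential using X subspace_scale[OF assms]
    by (intro exI[of _ "\<lambda>n. c *\<^sub>R X n"]) (auto intro: tendsto_scaleR)
qed

text \<open>A vector orthogonal to the range of the adjoint lies in the kernel of \<open>A\<close>, which is trivial.
  Hence each \<open>x\<close> equals its projection on the closure of that range.\<close>

lemma closure_range_adjoint:
  fixes A :: "'a::{real_inner, complete_space} \<Rightarrow> 'b::real_inner"
  assumes A: "bounded_linear A" and "inj A"
  shows "closure (range (adjoint A)) = UNIV"
proof -
  interpret bounded_linear A by fact
  have "x \<in> closure (range (adjoint A))" for x
  proof -
    have "subspace (range (adjoint A))"
      using linear_adjoint[OF A] by (rule linear_subspace_image) simp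
    then obtain y where y: "y \<in> closure (range (adjoint A))"
        and orth: "x - y \<in> orthogonal_comp (closure (range (adjoint A)))"
      using projection_theorem[OF subspace_closure closed_closure] by blast
    have "(x - y) \<bullet> adjoint A q = 0" for q
    proof -
      have "adjoint A q \<in> closure (range (adjoint A))"
        by (rule subsetD[OF closure_subset]) simp
      then show ?thesis
        using orth by (simp add: orthogonal_comp_def orthogonal_def inner_commute[of "x - y"])
    qed
    then have "A (x - y) \<bullet> A (x - y) = 0"
      by (simp add: inner_adjoint[OF A])
    then have "x = y"
      using \<open>inj A\<close> by (simp add: diff inj_def)
    then show ?thesis
      using y by simp
  qed
  then show ?thesis
    by blast
qed

section \<open>From convergence of images to strong convergence\<close>

text \<open>The norm bound gives \<open>\<parallel>v - u\<parallel>\<^sup>2 \<le> 2 (u - v, u)\<close>, so it is enough to test \<open>u - v\<close> against the fixed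
  vector \<open>u\<close>. If \<open>u\<close> were \<open>A\<^sup>* q\<close>, the product would be \<open>(A u - A v, q)\<close>, which tends to zero; in
  general \<open>u\<close> is approximated by such vectors, and boundedness of \<open>v\<close> controls the error.\<close>

lemma tendsto_of_image_tendsto_and_norm_le:
  fixes A :: "'a::{real_inner, complete_space} \<Rightarrow> 'b::real_inner"
  assumes A: "bounded_linear A" "inj A"
    and lim: "((\<lambda>t. A (v t)) \<longlongrightarrow> A u) F"
    and le: "\<forall>\<^sub>F t in F. norm (v t) \<le> norm u"
  shows "(v \<longlongrightarrow> u) F"
proof (rule tendstoI)
  fix e :: real assume "e > 0"
  interpret bounded_linear A by fact
  \<comment> \<open>The tolerances \<open>\<eta>\<close> and \<open>\<rho>\<close> let the two products in the estimate below contribute at most \<open>e\<^sup>2 / 2\<close> each.\<close>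
  define \<eta> where "\<eta> = e\<^sup>2 / (8 * (norm u + 1))"
  have "\<eta> > 0"
    using \<open>e > 0\<close> by (simp add: \<eta>_def add_nonneg_pos)
  then obtain q where q: "norm (u - adjoint A q) < \<eta>"
    using closure_range_adjoint[OF A] closure_approachable[of u "range (adjoint A)"]
    by (auto simp: dist_norm norm_minus_commute)
  define \<rho> where "\<rho> = e\<^sup>2 / (4 * (norm q + 1))"
  have "\<rho> > 0"
    using \<open>e > 0\<close> by (simp add: \<rho>_def add_nonneg_pos)
  with lim have "\<forall>\<^sub>F t in F. norm (A u - A (v t)) < \<rho>"
    by (simp add: tendsto_iff dist_norm norm_minus_commute)
  with le show "\<forall>\<^sub>F t in F. dist (v t) u < e"
  proof eventually_elim
    case (elim t)
    have "(norm (v t))\<^sup>2 \<le> (norm u)\<^sup>2"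
      using elim(1) by (simp add: power_mono)
    then have "(norm (v t - u))\<^sup>2 \<le> 2 * ((u - v t) \<bullet> u)"
      unfolding power2_norm_eq_inner by (simp add: inner_diff inner_commute)
    also have "\<dots> = 2 * ((u - v t) \<bullet> (u - adjoint A q)) + 2 * ((A u - A (v t)) \<bullet> q)"
      by (simp add: inner_diff inner_adjoint[OF A(1)] diff)
    also have "\<dots> < e\<^sup>2"
    proof -
      have "norm (u - v t) \<le> 2 * norm u"
        using norm_triangle_ineq4[of u "v t"] elim(1) by simp
      then have "norm (u - v t) * norm (u - adjoint A q) \<le> (2 * norm u) * \<eta>"
        using q by (intro mult_mono) auto
      also have "\<dots> < 2 * (norm u + 1) * \<eta>"
        using \<open>\<eta> > 0\<close> by simp
      also have "\<dots> = e\<^sup>2 / 4"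
        using add_pos_nonneg[of 8 "norm u * 8"] by (simp add: \<eta>_def field_simps)
      finally have 1: "(u - v t) \<bullet> (u - adjoint A q) < e\<^sup>2 / 4"
        using norm_cauchy_schwarz[of "u - v t" "u - adjoint A q"] by linarith
      have "norm (A u - A (v t)) * norm q \<le> \<rho> * (norm q + 1)"
        using elim(2) \<open>\<rho> > 0\<close> by (intro mult_mono) auto
      also have "\<dots> = e\<^sup>2 / 4"
        using add_pos_nonneg[of 4 "norm q * 4"] by (simp add: \<rho>_def field_simps)
      finally have 2: "(A u - A (v t)) \<bullet> q \<le> e\<^sup>2 / 4"
        using norm_cauchy_schwarz[of "A u - A (v t)" q] by linarith
      show ?thesis
        using 1 2 by linarith
    qed
    finally show ?case
      using \<open>e > 0\<close> by (simp add: dist_norm power_less_imp_less_base)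
  qed
qed

section \<open>Optimality conditions for the penalized functional\<close>

text \<open>Compare the minimizer with \<open>p + t (q - p)\<close>, where \<open>0 < t < 1\<close>. The quadratic part expands exactly, and
  the seminorm \<open>\<parallel>q - P q\<parallel>\<close>, which need not be differentiable where it vanishes, is bounded by convexity.
  Division by \<open>t\<close> and the limit \<open>t \<rightarrow> 0\<close> remove the second order term.\<close>

lemma G_P_variational_inequality:
  fixes A :: "'v::{real_inner, complete_space} \<Rightarrow> 'h::real_inner"
  assumes A: "bounded_linear A" and P: "linear P" and "\<delta> \<ge> 0"
    and min: "is_arg_min (G_P A P \<delta> b) (\<lambda>q. True) p"
  shows "adjoint A p \<bullet> adjoint A (q - p) + \<delta> * (norm (q - P q) - norm (p - P p)) \<ge> b \<bullet> (q - p)"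
proof -
  let ?c = "adjoint A p \<bullet> adjoint A (q - p) + \<delta> * (norm (q - P q) - norm (p - P p)) - b \<bullet> (q - p)"
  let ?k = "1/2 * (norm (adjoint A (q - p)))\<^sup>2"
  have "0 \<le> ?c + t * ?k" if t: "0 < t" "t < 1" for t
  proof -
    let ?m = "p + t *\<^sub>R (q - p)"
    interpret P: linear P by fact
    have "?m - P ?m = (1 - t) *\<^sub>R (p - P p) + t *\<^sub>R (q - P q)"
      by (simp add: P.add P.scale P.diff algebra_simps)
    then have "norm (?m - P ?m) \<le> (1 - t) * norm (p - P p) + t * norm (q - P q)"
      using t norm_triangle_ineq[of "(1 - t) *\<^sub>R (p - P p)" "t *\<^sub>R (q - P q)"] by simp
    then have N: "\<delta> * norm (?m - P ?m) \<le> \<delta> * ((1 - t) * norm (p - P p) + t * norm (q - P q))"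
      using \<open>\<delta> \<ge> 0\<close> by (rule mult_left_mono)
    have Q: "(norm (adjoint A ?m))\<^sup>2 = (norm (adjoint A p))\<^sup>2
        + 2 * t * (adjoint A p \<bullet> adjoint A (q - p)) + t * t * (norm (adjoint A (q - p)))\<^sup>2"
      using linear_adjoint[OF A] unfolding power2_norm_eq_inner
      by (simp add: linear_add linear_scale inner_add inner_commute distrib_left)
    have "G_P A P \<delta> b p \<le> G_P A P \<delta> b ?m"
      using min by (simp add: is_arg_min_linorder)
    then have "0 \<le> t * (?c + t * ?k)"
      using N unfolding G_P_def Q by (simp add: inner_add algebra_simps)
    then show ?thesis
      using t by (simp add: zero_le_mult_iff)
  qed
  then have "\<forall>\<^sub>F t in at_right 0. 0 \<le> ?c + t * ?k"
    using eventually_at_right_real[of 0 1] by (auto elim: eventually_mono)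
  moreover have "((\<lambda>t. ?c + t * ?k) \<longlongrightarrow> ?c + 0 * ?k) (at_right 0)"
    by (intro tendsto_intros)
  ultimately have "0 \<le> ?c + 0 * ?k"
    by (intro tendsto_lowerbound) auto
  then show ?thesis
    by simp
qed

text \<open>Test the variational inequality with the minimizer moved by the negative residual \<open>- r\<close>. The penalty
  grows by at most \<open>\<delta> \<parallel>r\<parallel>\<close>, so \<open>\<parallel>r\<parallel>\<^sup>2 \<le> \<delta> \<parallel>r\<parallel>\<close>.\<close>

lemma G_P_minimizer_residual:
  fixes A :: "'v::{real_inner, complete_space} \<Rightarrow> 'h::real_inner"
  assumes A: "bounded_linear A" and P: "linear P" and "\<delta> \<ge> 0"
    and contr: "\<And>h. norm (h - P h) \<le> norm h"
    and min: "is_arg_min (G_P A P \<delta> b) (\<lambda>q. True) p"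
  shows "norm (A (adjoint A p) - b) \<le> \<delta>"
proof -
  let ?r = "A (adjoint A p) - b"
  interpret P: linear P by fact
  have "norm ((p - ?r) - P (p - ?r)) \<le> norm (p - P p) + norm (?r - P ?r)"
    using norm_triangle_ineq4[of "p - P p" "?r - P ?r"] by (simp only: P.diff) (simp add: algebra_simps)
  then have "norm ((p - ?r) - P (p - ?r)) - norm (p - P p) \<le> norm ?r"
    using contr[of ?r] by linarith
  then have "\<delta> * (norm ((p - ?r) - P (p - ?r)) - norm (p - P p)) \<le> \<delta> * norm ?r"
    using \<open>\<delta> \<ge> 0\<close> by (rule mult_left_mono)
  then have "b \<bullet> (- ?r) \<le> A (adjoint A p) \<bullet> (- ?r) + \<delta> * norm ?r"
    using G_P_variational_inequality[OF A P \<open>\<delta> \<ge> 0\<close> min, of "p - ?r"]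
    by (simp add: inner_adjoint[OF A])
  then have "norm ?r * norm ?r \<le> \<delta> * norm ?r"
    unfolding power2_eq_square[symmetric] power2_norm_eq_inner by (simp add: inner_diff inner_commute)
  then show ?thesis
    using \<open>\<delta> \<ge> 0\<close> by (cases "?r = 0") (auto simp: mult_le_cancel_right)
qed

text \<open>The variational inequality tested with \<open>q = 0\<close>.\<close>

lemma G_P_minimizer_energy:
  fixes A :: "'v::{real_inner, complete_space} \<Rightarrow> 'h::real_inner"
  assumes A: "bounded_linear A" and P: "linear P" and "\<delta> \<ge> 0"
    and min: "is_arg_min (G_P A P \<delta> b) (\<lambda>q. True) p"
  shows "(norm (adjoint A p))\<^sup>2 + \<delta> * norm (p - P p) \<le> b \<bullet> p"
  using G_P_variational_inequality[OF A P \<open>\<delta> \<ge> 0\<close> min, of 0]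
    linear_neg[OF linear_adjoint[OF A]] linear_0[OF P]
  by (simp add: power2_norm_eq_inner)

text \<open>The noise \<open>b - A u\<close> is orthogonal to the range of \<open>P\<close>, so its product with \<open>p\<close> is at most
  \<open>\<delta> \<parallel>p - P p\<parallel>\<close>, which is the penalty term in the energy estimate. What remains is
  \<open>\<parallel>A\<^sup>* p\<parallel>\<^sup>2 \<le> (A u, p) = (u, A\<^sup>* p)\<close>.\<close>

lemma G_P_minimizer_norm_le:
  fixes A :: "'v::{real_inner, complete_space} \<Rightarrow> 'h::real_inner"
  assumes A: "bounded_linear A" and P: "linear P" and "\<delta> \<ge> 0"
    and noise: "norm (b - A u) \<le> \<delta>" "\<And>q. (b - A u) \<bullet> P q = 0"
    and min: "is_arg_min (G_P A P \<delta> b) (\<lambda>q. True) p"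
  shows "norm (adjoint A p) \<le> norm u"
proof -
  have "(b - A u) \<bullet> p = (b - A u) \<bullet> (p - P p)"
    using noise(2)[of p] by (simp add: inner_diff_right)
  also have "\<dots> \<le> norm (b - A u) * norm (p - P p)"
    by (rule norm_cauchy_schwarz)
  also have "\<dots> \<le> \<delta> * norm (p - P p)"
    using noise(1) by (simp add: mult_right_mono)
  finally have "b \<bullet> p \<le> A u \<bullet> p + \<delta> * norm (p - P p)"
    by (simp add: inner_diff_left)
  then have "(norm (adjoint A p))\<^sup>2 \<le> u \<bullet> adjoint A p"
    using G_P_minimizer_energy[OF A P \<open>\<delta> \<ge> 0\<close> min] by (simp add: inner_adjoint[OF A])
  also have "\<dots> \<le> norm u * norm (adjoint A p)"
    by (rule norm_cauchy_schwarz)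
  finally show ?thesis
    by (cases "adjoint A p = 0") (auto simp: power2_eq_square mult_le_cancel_right)
qed

section \<open>Convergence of the regularized solutions\<close>

theorem theorem2p4:
  fixes A :: "'v::{real_inner, complete_space} \<Rightarrow> 'h::{real_inner, complete_space}"
    and P :: "'h \<Rightarrow> 'h"
    and u :: 'v and g :: 'h and \<delta>\<^sub>0 :: real
    and g\<delta> :: "real \<Rightarrow> 'h" and p\<delta> :: "real \<Rightarrow> 'h" and u\<delta> :: "real \<Rightarrow> 'v"
  assumes "bounded_linear A" and "inj A"
    and "orthogonal_projector P" and "compact_operator P"
    and "range P \<subseteq> closure (range A)"
    and "A u = g"
    and "\<delta>\<^sub>0 > 0"
    and "\<And>\<delta>. \<delta> \<in> {0<..<\<delta>\<^sub>0} \<Longrightarrow> norm (orth_proj (orthogonal_comp (range A)) (g\<delta> \<delta>)) < \<delta>"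
    and "\<And>\<delta>. \<delta> \<in> {0<..<\<delta>\<^sub>0} \<Longrightarrow> \<delta> < norm (g\<delta> \<delta>)"
    and "\<And>\<delta>. \<delta> \<in> {0<..<\<delta>\<^sub>0} \<Longrightarrow> norm (g\<delta> \<delta> - g) = \<delta>"
    and "\<And>\<delta>. \<delta> \<in> {0<..<\<delta>\<^sub>0} \<Longrightarrow> P (g\<delta> \<delta>) = P g"
    and "\<And>\<delta>. \<delta> \<in> {0<..<\<delta>\<^sub>0} \<Longrightarrow> is_arg_min (G_P A P \<delta> (g\<delta> \<delta>)) (\<lambda>q. True) (p\<delta> \<delta>)"
    and "\<And>\<delta>. \<delta> \<in> {0<..<\<delta>\<^sub>0} \<Longrightarrow> u\<delta> \<delta> = adjoint A (p\<delta> \<delta>)"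
  shows "(u\<delta> \<longlongrightarrow> u) (at_right 0)"
proof -
  note A = assms(1) and noise = assms(10) and data = assms(11) and min = assms(12)
  have P: "linear P"
    using assms(4) by (simp add: compact_operator_def bounded_linear.linear)
  note P_residual = orthogonal_projector_residual[OF assms(3)]
  note contr = orthogonal_projector_residual_norm_le[OF assms(3)]
  have small: "\<forall>\<^sub>F \<delta> in at_right 0. \<delta> \<in> {0<..<\<delta>\<^sub>0}"
    using \<open>\<delta>\<^sub>0 > 0\<close> by (rule eventually_at_right_real)
  have bound: "norm (u\<delta> \<delta>) \<le> norm u" if \<delta>: "\<delta> \<in> {0<..<\<delta>\<^sub>0}" for \<delta>
  proof -
    have "(g\<delta> \<delta> - A u) \<bullet> P q = 0" for q
      using P_residual[of "g\<delta> \<delta> - A u" q] data[OF \<delta>] linear_diff[OF P] by (simp add: assms(6))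
    then show ?thesis
      using G_P_minimizer_norm_le[OF A P _ _ _ min[OF \<delta>], of u] \<delta> noise[OF \<delta>] assms(13)[OF \<delta>]
      by (simp add: assms(6))
  qed
  have residual: "norm (A (u\<delta> \<delta>) - A u) \<le> 2 * \<delta>" if \<delta>: "\<delta> \<in> {0<..<\<delta>\<^sub>0}" for \<delta>
  proof -
    have "norm (A (u\<delta> \<delta>) - g\<delta> \<delta>) \<le> \<delta>"
      using G_P_minimizer_residual[OF A P _ contr min[OF \<delta>]] \<delta> assms(13)[OF \<delta>] by simp
    then show ?thesis
      using noise[OF \<delta>] norm_triangle_ineq[of "A (u\<delta> \<delta>) - g\<delta> \<delta>" "g\<delta> \<delta> - g"] by (simp add: assms(6))
  qed
  have "((\<lambda>\<delta>. A (u\<delta> \<delta>) - A u) \<longlongrightarrow> 0) (at_right 0)"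
  proof (rule Lim_null_comparison)
    show "\<forall>\<^sub>F \<delta> in at_right 0. norm (A (u\<delta> \<delta>) - A u) \<le> 2 * \<delta>"
      using small by (rule eventually_mono) (rule residual)
    have "((\<lambda>\<delta>::real. 2 * \<delta>) \<longlongrightarrow> 2 * 0) (at_right 0)"
      by (intro tendsto_intros)
    then show "((\<lambda>\<delta>::real. 2 * \<delta>) \<longlongrightarrow> 0) (at_right 0)"
      by simp
  qed
  then have "((\<lambda>\<delta>. A (u\<delta> \<delta>)) \<longlongrightarrow> A u) (at_right 0)"
    by (rule LIM_zero_cancel)
  moreover have "\<forall>\<^sub>F \<delta> in at_right 0. norm (u\<delta> \<delta>) \<le> norm u"
    using small by (rule eventually_mono) (rule bound)
  ultimately show ?thesis
    by (rule tendsto_of_image_tendsto_and_norm_le[OF A assms(2)])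
qed

end
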